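(* Let $G$ be an $N$-graph with assigned angles, and let the ambient space be $\mathbb R^2$. Then a network $\mathcal N=(G,\Gamma)$ satisfies the angle condition in terms of paths if and only if it satisfies the angle condition in terms of virtual tangents (for some choice of virtual tangent vectors).
   Context: Let $I_i=[0,1]\times\{i\}$ for $i=1,\dots,N$, $E=\bigcup_i I_i$, $V=\bigcup_i\{0,1\}\times\{i\}$. An $N$-graph is a topological quotient $G=E/\sim$, where $\sim$ identifies points of $V$ only; $\pi:E\to G$ is the projection, $E_i=\pi(I_i)$ the edges, $V_G=\pi(V)$ the vertices. For $p\in V_G$, $\pi^{-1}(p)$ is a finite set of pairs $(z,i)\in\{0,1\}\times\{1,\dots,N\}$. A subgraph is the union of a collection of edges with the same identifications. $G$ has assigned angles if a unit vector $d^{z,i}\in\mathbb S^1$ is given for each $(z,i)\in\{0,1\}\times\{1,\dots,N\}$. A network is a pair $\mathcal N=(G,\Gamma)$ with $\Gamma:G\to\mathbb R^2$ continuous such that each $\gamma^i=\Gamma|_{E_i}$ (viewed as a map on $[0,1]$) is either constant (singular curve) or an immersion of class $H^2$ (regular curve). $\mathrm{Sing}(\mathcal N)$ is the subgraph formed by the edges carrying singular curves, and $\mathrm{Reg}(\mathcal N)$ the one formed by the edges carrying regular curves. For a regular curve, the (real) outer tangents are $\tau^{z,i}=(-1)^z\dot\gamma^i(z)/|\dot\gamma^i(z)|$, $z\in\{0,1\}$. Angle condition in terms of virtual tangents: for every singular curve $\gamma^i$ there exist unit vectors $\tau^{0,i}=-\tau^{1,i}$ (virtual tangents) such that for every $p\in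 V_G$ there is a rotation $\mathrm R_p$ of $\mathbb R^2$ with $\tau^{z,i}=\mathrm R_p(d^{z,i})$ for all $(z,i)\in\pi^{-1}(p)$, where $\tau^{z,i}$ is the real outer tangent if $\gamma^i$ is regular and the virtual one if $\gamma^i$ is singular. Angles: for nonzero planar vectors $a,b$, $\angle a,b\in\mathbb R/2\pi\mathbb Z$ is the counterclockwise angle from $a$ to $b$. Paths: a path composed of $\mathcal J$ edges is a sequence $\mathcal P(j)=(z_j,i_j)\in\{0,1\}\times\{1,\dots,N\}$, $j=1,\dots,\mathcal J$, with $\pi(1-z_j,i_j)=\pi(z_{j+1},i_{j+1})$ for $1\le j\le\mathcal J-1$. It is a cycle if moreover $\pi(1-z_{\mathcal J},i_{\mathcal J})=\pi(z_1,i_1)$. A path that is not a cycle is called an open path. The angle of a path is, modulo $2\pi$, $\Theta(\mathcal P)=\sum_{j=1}^{\mathcal J-1}\angle(-d^{1-z_j,i_j}),d^{z_{j+1},i_{j+1}}$ if $\mathcal P$ is an open path, and $\Theta(\mathcal P)=\sum_{j=1}^{\mathcal J}\angle(-d^{1-z_j,i_j}),d^{z_{j+1},i_{j+1}}$ (indices modulo $\mathcal J$) if $\mathcal P$ is a cycle. Angle condition in terms of paths: (i) the regular curves satisfy the angle condition: for every $p\in V_G$ there is a rotation $\mathrm R_p$ with $\tau^{z,i}=\mathrm R_p(d^{z,i})$ for all $(z,i)\in\pi^{-1}(p)$ such that $\gamma^i$ is regular; (ii) for every cycle $\mathcal P$ all of whose edges $E_{i_j}$, $j=1,\dots,\mathcal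 J$, are in $\mathrm{Sing}(\mathcal N)$, one has $\Theta(\mathcal P)=0$ mod $2\pi$; (iii) for every open path $\mathcal P$ composed of $\mathcal J\ge2$ edges such that $E_{i_j}$ is in $\mathrm{Sing}(\mathcal N)$ for $2\le j\le\mathcal J-1$ and $E_{i_1},E_{i_{\mathcal J}}$ are in $\mathrm{Reg}(\mathcal N)$, one has $\Theta(\mathcal P)=\angle(-\tau^{1-z_1,i_1}),\tau^{z_{\mathcal J},i_{\mathcal J}}$ mod $2\pi$.
   Formalization: In (iii) paths whose two extreme vertices coincide are also included, with the angle measured as for an open path (no closing angle); with such paths excluded the claim fails, e.g. for a triangle with two regular edges and one singular edge. *)

theory Defs
  imports "HOL-Analysis.Analysis" "HOL-Library.Real_Mod"
begin

section \<open>Planar angles\<close>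

text \<open>
  The counterclockwise angle from \<open>a\<close> to \<open>b\<close>, computed as the argument of the quotient \<open>b / a\<close> of
  the corresponding complex numbers. This picks the representative in \<open>(-\<pi>, \<pi>]\<close>; angles are
  compared only modulo \<open>2\<pi>\<close> below.
\<close>

definition ccw_angle :: "real ^ 2 \<Rightarrow> real ^ 2 \<Rightarrow> real" where
  "ccw_angle a b = Arg (Complex (b $ 1) (b $ 2) / Complex (a $ 1) (a $ 2))"


section \<open>Immersed curves of class \<open>H\<^sup>2\<close>\<close>

definition test_function :: "(real \<Rightarrow> real) \<Rightarrow> bool" where
  "test_function \<phi> \<longleftrightarrow>
     (\<forall>k x. (deriv ^^ k) \<phi> differentiable (at x)) \<and> closure {x. \<phi> x \<noteq> 0} \<subseteq> {0<..<1}"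

definition in_L2 :: "(real \<Rightarrow> real ^ 2) \<Rightarrow> bool" where
  "in_L2 u \<longleftrightarrow>
     u \<in> borel_measurable (lebesgue_on {0<..<1}) \<and>
     integrable (lebesgue_on {0<..<1}) (\<lambda>t. (norm (u t))\<^sup>2)"

definition weak_derivative :: "nat \<Rightarrow> (real \<Rightarrow> real ^ 2) \<Rightarrow> (real \<Rightarrow> real ^ 2) \<Rightarrow> bool" where
  "weak_derivative k u w \<longleftrightarrow>
     (\<forall>\<phi>. test_function \<phi> \<longrightarrow>
        (LINT t|lebesgue_on {0<..<1}. (deriv ^^ k) \<phi> t *\<^sub>R u t) =
        (-1) ^ k *\<^sub>R (LINT t|lebesgue_on {0<..<1}. \<phi> t *\<^sub>R w t))"

definition class_H2 :: "(real \<Rightarrow> real ^ 2) \<Rightarrow> bool" where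
  "class_H2 u \<longleftrightarrow>
     in_L2 u \<and> (\<exists>v w. in_L2 v \<and> in_L2 w \<and> weak_derivative 1 u v \<and> weak_derivative 2 u w)"

text \<open>Derivatives at the end points of \<open>[0, 1]\<close> are one-sided.\<close>

definition curve_deriv :: "(real \<Rightarrow> real ^ 2) \<Rightarrow> real \<Rightarrow> real ^ 2" where
  "curve_deriv u t = vector_derivative u (at t within {0..1})"

definition immersion :: "(real \<Rightarrow> real ^ 2) \<Rightarrow> bool" where
  "immersion u \<longleftrightarrow>
     (\<forall>t\<in>{0..1}. u differentiable (at t within {0..1})) \<and>
     continuous_on {0..1} (curve_deriv u) \<and>
     (\<forall>t\<in>{0..1}. curve_deriv u t \<noteq> 0)"


section \<open>\<open>N\<close>-graphs\<close>

definition intervals :: "nat \<Rightarrow> (real \<times> nat) set" where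
  "intervals N = {0..1} \<times> {1..N}"

definition end_points :: "nat \<Rightarrow> (real \<times> nat) set" where
  "end_points N = {0, 1} \<times> {1..N}"

text \<open>
  \<open>R\<close> is the identification of end points; every other point is identified with itself only.
  Points of the graph are equivalence classes. The ends of edges, which carry directions and make
  up paths, are indexed by pairs \<open>(z, i)\<close> of natural numbers with \<open>z \<in> {0, 1}\<close>.
\<close>

locale N_graph =
  fixes N :: nat and R :: "((real \<times> nat) \<times> (real \<times> nat)) set"
  assumes equiv_R: "equiv (end_points N) R"
begin

definition gluing :: "((real \<times> nat) \<times> (real \<times> nat)) set" where
  "gluing = R \<union> Id_on (intervals N)"

definition proj :: "real \<times> nat \<Rightarrow> (real \<times> nat) set" where
  "proj x = gluing `` {x}"

definition points :: "(real \<times> nat) set set" where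
  "points = intervals N // gluing"

definition graph_topology :: "(real \<times> nat) set topology" where
  "graph_topology =
     topology (\<lambda>U. U \<subseteq> points \<and>
       openin (top_of_set (intervals N)) {x \<in> intervals N. proj x \<in> U})"

definition vertices :: "(real \<times> nat) set set" where
  "vertices = proj ` end_points N"

definition ends :: "(nat \<times> nat) set" where
  "ends = {0, 1} \<times> {1..N}"

definition end_vertex :: "nat \<times> nat \<Rightarrow> (real \<times> nat) set" where
  "end_vertex = (\<lambda>(z, i). proj (real z, i))"

definition ends_at :: "(real \<times> nat) set \<Rightarrow> (nat \<times> nat) set" where
  "ends_at p = {e \<in> ends. end_vertex e = p}"

definition opposite :: "nat \<times> nat \<Rightarrow> nat \<times> nat" where
  "opposite = (\<lambda>(z, i). (1 - z, i))"

text \<open>Paths are nonempty lists of ends, so that positions are counted from \<open>0\<close>.\<close>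

definition is_path :: "(nat \<times> nat) list \<Rightarrow> bool" where
  "is_path P \<longleftrightarrow>
     P \<noteq> [] \<and> set P \<subseteq> ends \<and>
     (\<forall>j. Suc j < length P \<longrightarrow> end_vertex (opposite (P ! j)) = end_vertex (P ! Suc j))"

definition is_cycle :: "(nat \<times> nat) list \<Rightarrow> bool" where
  "is_cycle P \<longleftrightarrow> is_path P \<and> end_vertex (opposite (last P)) = end_vertex (hd P)"

end

lemma (in N_graph) equiv_gluing: "equiv (intervals N) gluing"
proof -
  have "R \<subseteq> intervals N \<times> intervals N" "sym R" "trans R"
    using equiv_R by (auto simp: equiv_def refl_on_def end_points_def intervals_def)
  thus ?thesis
    unfolding gluing_def equiv_def refl_on_def sym_def trans_def by blast
qed

lemma (in N_graph) istopology_graph: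
  "istopology (\<lambda>U. U \<subseteq> points \<and>
     openin (top_of_set (intervals N)) {x \<in> intervals N. proj x \<in> U})"
proof -
  have Int: "{x \<in> intervals N. proj x \<in> S \<inter> T} =
      {x \<in> intervals N. proj x \<in> S} \<inter> {x \<in> intervals N. proj x \<in> T}" for S T
    by auto
  have Un: "{x \<in> intervals N. proj x \<in> \<Union>K} = (\<Union>S\<in>K. {x \<in> intervals N. proj x \<in> S})" for K
    by auto
  show ?thesis
    unfolding istopology_def Int Un by (auto intro: openin_Int openin_Union)
qed

text \<open>\<open>graph_topology\<close> is indeed the quotient topology.\<close>

lemma (in N_graph) quotient_map_proj:
  "quotient_map (top_of_set (intervals N)) graph_topology proj"
proof -
  have op: "openin graph_topology U \<longleftrightarrow> U \<subseteq> points \<and>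
      openin (top_of_set (intervals N)) {x \<in> intervals N. proj x \<in> U}" for U
    unfolding graph_topology_def using istopology_graph by (simp add: topology_inverse')
  have img: "proj ` intervals N = points"
    by (auto simp: points_def proj_def quotient_def)
  have "{x \<in> intervals N. proj x \<in> points} = intervals N"
    using img by auto
  hence "openin graph_topology points"
    by (simp add: op)
  hence top: "topspace graph_topology = points"
    by (metis op openin_subset openin_topspace subset_antisym)
  show ?thesis
    unfolding quotient_map_def top using img by (auto simp: op)
qed


section \<open>Assigned angles\<close>

locale angle_graph = N_graph +
  fixes d :: "nat \<Rightarrow> nat \<Rightarrow> real ^ 2"
  assumes norm_d: "\<And>z i. (z, i) \<in> ends \<Longrightarrow> norm (d z i) = 1"
begin

definition dir :: "nat \<times> nat \<Rightarrow> real ^ 2" where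
  "dir = (\<lambda>(z, i). d z i)"

definition open_path_angle :: "(nat \<times> nat) list \<Rightarrow> real" where
  "open_path_angle P =
     (\<Sum>j<length P - 1. ccw_angle (- dir (opposite (P ! j))) (dir (P ! Suc j)))"

definition cycle_angle :: "(nat \<times> nat) list \<Rightarrow> real" where
  "cycle_angle P =
     (\<Sum>j<length P. ccw_angle (- dir (opposite (P ! j))) (dir (P ! (Suc j mod length P))))"

end


section \<open>Networks and the two angle conditions\<close>

locale network = angle_graph +
  fixes \<Gamma> :: "(real \<times> nat) set \<Rightarrow> real ^ 2"
  assumes continuous_\<Gamma>: "continuous_map graph_topology euclidean \<Gamma>"
    and constant_or_immersed:
      "\<And>i. i \<in> {1..N} \<Longrightarrow>
         (\<lambda>t. \<Gamma> (proj (t, i))) constant_on {0..1} \<or>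
         immersion (\<lambda>t. \<Gamma> (proj (t, i))) \<and> class_H2 (\<lambda>t. \<Gamma> (proj (t, i)))"
begin

definition curve :: "nat \<Rightarrow> real \<Rightarrow> real ^ 2" where
  "curve i t = \<Gamma> (proj (t, i))"

text \<open>Distinct edges are distinct as sets, so subgraphs amount to sets of edge indices.\<close>

definition Sing :: "nat set" where
  "Sing = {i \<in> {1..N}. curve i constant_on {0..1}}"

definition Reg :: "nat set" where
  "Reg = {i \<in> {1..N}. immersion (curve i) \<and> class_H2 (curve i)}"

definition outer_tangent :: "nat \<times> nat \<Rightarrow> real ^ 2" where
  "outer_tangent = (\<lambda>(z, i).
     ((-1) ^ z / norm (curve_deriv (curve i) (real z))) *\<^sub>R curve_deriv (curve i) (real z))"

definition virtual_angle_condition :: bool where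
  "virtual_angle_condition \<longleftrightarrow>
     (\<exists>\<sigma> :: nat \<times> nat \<Rightarrow> real ^ 2.
        (\<forall>i\<in>Sing. norm (\<sigma> (0, i)) = 1 \<and> norm (\<sigma> (1, i)) = 1 \<and> \<sigma> (0, i) = - \<sigma> (1, i)) \<and>
        (\<forall>p\<in>vertices. \<exists>Q :: real ^ 2 ^ 2. rotation_matrix Q \<and>
           (\<forall>e\<in>ends_at p.
              (if snd e \<in> Reg then outer_tangent e else \<sigma> e) = Q *v dir e)))"

definition regular_angle_condition :: bool where
  "regular_angle_condition \<longleftrightarrow>
     (\<forall>p\<in>vertices. \<exists>Q :: real ^ 2 ^ 2. rotation_matrix Q \<and>
        (\<forall>e\<in>ends_at p. snd e \<in> Reg \<longrightarrow> outer_tangent e = Q *v dir e))"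

definition singular_cycle_condition :: bool where
  "singular_cycle_condition \<longleftrightarrow>
     (\<forall>P. is_cycle P \<and> (\<forall>e\<in>set P. snd e \<in> Sing) \<longrightarrow> [cycle_angle P = 0] (rmod 2 * pi))"

text \<open>
  A path from a regular edge to a regular edge through singular ones is always measured as an open
  path, i.e. without an angle between its last and its first edge, even if its two extreme
  vertices happen to coincide. Such paths must not be left out: take a triangle with vertices
  \<open>a, p, q\<close>, regular edges from \<open>a\<close> to \<open>p\<close> and from \<open>q\<close> to \<open>a\<close>, and a singular edge from \<open>p\<close> to
  \<open>q\<close>. The directions of the singular edge are constrained by virtual tangents, but every path
  from one regular edge across the singular one to the other starts and ends at \<open>a\<close>.
\<close>

definition regular_path_condition :: bool where
  "regular_path_condition \<longleftrightarrow>
     (\<forall>P. is_path P \<and> 2 \<le> length P \<and>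
        (\<forall>j. 0 < j \<and> j < length P - 1 \<longrightarrow> snd (P ! j) \<in> Sing) \<and>
        snd (hd P) \<in> Reg \<and> snd (last P) \<in> Reg \<longrightarrow>
        [open_path_angle P =
           ccw_angle (- outer_tangent (opposite (hd P))) (outer_tangent (last P))] (rmod 2 * pi))"

definition path_angle_condition :: bool where
  "path_angle_condition \<longleftrightarrow>
     regular_angle_condition \<and> singular_cycle_condition \<and> regular_path_condition"

end

end

theory Submission
  imports Defs
begin

text \<open>
  Identify the plane with \<open>\<complex>\<close>. Rotations become multiplications by unit complex numbers, and an
  angle modulo \<open>2\<pi>\<close> becomes, through \<open>cis\<close>, a quotient of unit complex numbers. Choosing virtual
  tangents then amounts to choosing one unit number \<open>r p\<close> per vertex, the rotation at \<open>p\<close>: it has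
  to be the quotient of tangent and assigned direction at every regular end of an edge at \<open>p\<close>, and
  the requirement that the two virtual tangents of a singular edge be opposite says that \<open>r\<close> at one
  end of the edge is \<open>r\<close> at the other end times a factor depending only on the assigned
  directions, the \<open>transport\<close> factor of the edge. The predicate \<open>framing\<close> collects these
  constraints, and \<open>virtual_angle_condition_iff_framing\<close> records this translation.

  A framing is thus a multiplicative potential on the graph of singular edges, with prescribed
  values at the vertices that meet a regular edge. The classical obstructions to the existence of a
  potential are the products of the factors around closed walks, which must be \<open>1\<close>, and the products
  along walks between two vertices with prescribed values, which must be the quotient of these
  values. If they vanish, the potential is defined by transport from one base vertex per connected
  component (\<open>multiplicative_potential_exists\<close>). Finally, the turning angles along a path
  telescope into the product of the transport factors (\<open>cis_open_path_angle\<close>), so the two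
  obstructions are exactly the conditions on singular cycles and on paths between regular edges.
\<close>

section \<open>Unit vectors and rotations of the plane as complex numbers\<close>

definition cplx :: "real ^ 2 \<Rightarrow> complex" where
  "cplx v = Complex (v $ 1) (v $ 2)"

lemma cplx_minus [simp]: "cplx (- v) = - cplx v"
  by (simp add: cplx_def complex_eq_iff)

lemma cplx_eq_iff [simp]: "cplx v = cplx w \<longleftrightarrow> v = w"
  by (simp add: cplx_def vec_eq_iff forall_2)

lemma norm_cplx [simp]: "norm (cplx v) = norm v"
  by (simp add: cplx_def cmod_def norm_vec_def L2_set_def sum_2)

lemma cplx_surj: "\<exists>v. cplx v = z"
  by (rule exI[of _ "vector [Re z, Im z]"]) (simp add: cplx_def complex_eq_iff)

lemma cis_ccw_angle:
  assumes "norm a = 1" "norm b = 1"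
  shows "cis (ccw_angle a b) = cplx b / cplx a"
proof -
  have n: "norm (cplx b / cplx a) = 1"
    using assms by (simp add: norm_divide)
  hence "cplx b / cplx a \<noteq> 0"
    by (metis norm_zero zero_neq_one)
  hence "cis (Arg (cplx b / cplx a)) = sgn (cplx b / cplx a)"
    by (rule cis_Arg)
  also have "\<dots> = cplx b / cplx a"
    unfolding sgn_div_norm n by simp
  finally show ?thesis
    by (simp add: ccw_angle_def cplx_def)
qed

lemma rotation_matrix_imp_cplx:
  fixes Q :: "real ^ 2 ^ 2"
  assumes "rotation_matrix Q"
  obtains c where "norm c = 1" "\<And>v. cplx (Q *v v) = c * cplx v"
proof -
  define \<alpha> \<beta> \<gamma> \<delta> where "\<alpha> = Q $ 1 $ 1" and "\<beta> = Q $ 1 $ 2" and "\<gamma> = Q $ 2 $ 1" and "\<delta> = Q $ 2 $ 2"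
  have "transpose Q ** Q = mat 1" and det: "\<alpha> * \<delta> - \<beta> * \<gamma> = 1"
    using assms
    by (auto simp: rotation_matrix_def orthogonal_matrix_def det_2 \<alpha>_def \<beta>_def \<gamma>_def \<delta>_def)
  hence cols: "\<alpha>\<^sup>2 + \<gamma>\<^sup>2 = 1" "\<beta>\<^sup>2 + \<delta>\<^sup>2 = 1"
    by (simp_all add: vec_eq_iff forall_2 matrix_matrix_mult_def transpose_def mat_def sum_2
        \<alpha>_def \<beta>_def \<gamma>_def \<delta>_def power2_eq_square)
  have "(\<alpha> - \<delta>)\<^sup>2 + (\<beta> + \<gamma>)\<^sup>2 = (\<alpha>\<^sup>2 + \<gamma>\<^sup>2) + (\<beta>\<^sup>2 + \<delta>\<^sup>2) - 2 * (\<alpha> * \<delta> - \<beta> * \<gamma>)"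
    by (simp add: power2_eq_square algebra_simps)
  also have "\<dots> = 0"
    using cols det by simp
  finally have eq: "\<delta> = \<alpha>" "\<beta> = - \<gamma>"
    by (simp_all add: sum_power2_eq_zero_iff)
  show ?thesis
  proof
    show "norm (Complex \<alpha> \<gamma>) = 1"
      using cols by (simp add: cmod_def)
    show "cplx (Q *v v) = Complex \<alpha> \<gamma> * cplx v" for v
      using eq by (simp add: cplx_def complex_eq_iff matrix_vector_mult_def sum_2
        \<alpha>_def \<beta>_def \<gamma>_def \<delta>_def)
  qed
qed

lemma cplx_imp_rotation_matrix:
  assumes "norm c = 1"
  obtains Q :: "real ^ 2 ^ 2" where "rotation_matrix Q" "\<And>v. cplx (Q *v v) = c * cplx v"
proof
  define Q :: "real ^ 2 ^ 2" where "Q = vector [vector [Re c, - Im c], vector [Im c, Re c]]"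
  have "(Re c)\<^sup>2 + (Im c)\<^sup>2 = 1"
    using assms by (simp add: cmod_def)
  thus "rotation_matrix Q"
    by (simp add: rotation_matrix_def orthogonal_matrix det_2 vec_eq_iff forall_2
        matrix_matrix_mult_def transpose_def mat_def sum_2 Q_def power2_eq_square algebra_simps)
  show "cplx (Q *v v) = c * cplx v" for v
    by (simp add: cplx_def complex_eq_iff matrix_vector_mult_def sum_2 Q_def)
qed

lemma ex_rotation_matrix_iff_ex_unit:
  "(\<exists>Q :: real ^ 2 ^ 2. rotation_matrix Q \<and> (\<forall>x\<in>X. P x \<longrightarrow> f x = Q *v g x)) \<longleftrightarrow>
   (\<exists>c. norm c = 1 \<and> (\<forall>x\<in>X. P x \<longrightarrow> cplx (f x) = c * cplx (g x)))" (is "?L \<longleftrightarrow> ?R")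
proof
  assume ?L
  then obtain Q :: "real ^ 2 ^ 2"
    where Q: "rotation_matrix Q" "\<forall>x\<in>X. P x \<longrightarrow> f x = Q *v g x" by blast
  obtain c where "norm c = 1" "\<And>v. cplx (Q *v v) = c * cplx v"
    using rotation_matrix_imp_cplx[OF Q(1)] by blast
  with Q(2) show ?R by (intro exI[of _ c]) simp
next
  assume ?R
  then obtain c where c: "norm c = 1" "\<forall>x\<in>X. P x \<longrightarrow> cplx (f x) = c * cplx (g x)" by blast
  obtain Q :: "real ^ 2 ^ 2" where Q: "rotation_matrix Q" "\<And>v. cplx (Q *v v) = c * cplx v"
    using cplx_imp_rotation_matrix[OF c(1)] by blast
  have "\<forall>x\<in>X. P x \<longrightarrow> cplx (f x) = cplx (Q *v g x)"
    using c(2) Q(2) by simp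
  with Q(1) show ?L by auto
qed


section \<open>Multiplicative potentials\<close>

text \<open>
  Read \<open>T p q a\<close> as: some walk leads from \<open>p\<close> to \<open>q\<close> and the product of its factors is \<open>a\<close>. On each
  connected component the potential is obtained by transporting one value from a base point; if the
  component meets \<open>B\<close>, where values are prescribed, the base point has to be taken there. The
  assumption on closed walks makes transport independent of the walk.
\<close>

lemma multiplicative_potential_exists:
  fixes T :: "'v \<Rightarrow> 'v \<Rightarrow> complex \<Rightarrow> bool" and b :: "'v \<Rightarrow> complex"
  assumes refl: "\<And>p. T p p 1"
    and trans: "\<And>p q s a c. T p q a \<Longrightarrow> T q s c \<Longrightarrow> T p s (a * c)"
    and sym: "\<And>p q a. T p q a \<Longrightarrow> T q p (inverse a)"
    and unit: "\<And>p q a. T p q a \<Longrightarrow> norm a = 1"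
    and closed: "\<And>p a. T p p a \<Longrightarrow> a = 1"
    and unit_b: "\<And>p. p \<in> B \<Longrightarrow> norm (b p) = 1"
    and between: "\<And>p q a. T p q a \<Longrightarrow> p \<in> B \<Longrightarrow> q \<in> B \<Longrightarrow> b q = a * b p"
  obtains r where "\<And>p. norm (r p) = 1" "\<And>p. p \<in> B \<Longrightarrow> r p = b p"
    "\<And>p q a. T p q a \<Longrightarrow> r q = a * r p"
proof -
  define comp where "comp p = {q. \<exists>a. T p q a}" for p
  define rep where "rep C = (SOME q. q \<in> C \<and> (C \<inter> B \<noteq> {} \<longrightarrow> q \<in> B))" for C
  define base where "base p = rep (comp p)" for p
  define c where "c p = (SOME a. T (base p) p a)" for p
  define r where "r p = c p * (if base p \<in> B then b (base p) else 1)" for p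
  have self: "p \<in> comp p" for p
    using refl by (auto simp: comp_def)
  have rep: "base p \<in> comp p \<and> (comp p \<inter> B \<noteq> {} \<longrightarrow> base p \<in> B)" for p
    unfolding base_def rep_def by (rule someI_ex) (use self in blast)
  have comp_eq: "comp p = comp q" if "T p q a" for p q a
    unfolding comp_def using that trans sym by blast
  have base_eq: "base p = base q" if "T p q a" for p q a
    using comp_eq[OF that] by (simp add: base_def)
  have T_c: "T (base p) p (c p)" for p
    unfolding c_def by (rule someI_ex) (use rep[of p] sym in \<open>auto simp: comp_def\<close>)
  show ?thesis
  proof
    show "norm (r p) = 1" for p
      using unit[OF T_c] unit_b by (simp add: r_def norm_mult)
    show "r p = b p" if "p \<in> B" for p
    proof -
      have "base p \<in> B"
        using rep[of p] self that by blast
      thus ?thesis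
        using between[OF T_c] that by (simp add: r_def)
    qed
    show "r q = a * r p" if "T p q a" for p q a
    proof -
      have "T (base p) q (c p * a)"
        using trans[OF T_c that] .
      hence "T q (base p) (inverse (c p * a))"
        by (rule sym)
      moreover have "T (base p) q (c q)"
        using T_c[of q] base_eq[OF that] by simp
      ultimately have "T (base p) (base p) (c q * inverse (c p * a))"
        using trans by blast
      hence "c q * inverse (c p * a) = 1"
        by (rule closed)
      hence "c q = c p * a"
        by (metis inverse_zero mult_zero_right zero_neq_one divide_inverse eq_divide_imp
            mult.left_neutral nonzero_divide_eq_eq)
      thus ?thesis
        using base_eq[OF that] by (simp add: r_def)
    qed
  qed
qed


section \<open>Walks\<close>

context N_graph
begin

lemma opposite_in_ends [simp]: "e \<in> ends \<Longrightarrow> opposite e \<in> ends"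
  by (auto simp: ends_def opposite_def)

lemma opposite_opposite [simp]: "e \<in> ends \<Longrightarrow> opposite (opposite e) = e"
  by (auto simp: ends_def opposite_def)

lemma snd_opposite [simp]: "snd (opposite e) = snd e"
  by (simp add: opposite_def split: prod.split)

lemma vertices_eq: "vertices = end_vertex ` ends"
proof -
  have "end_points N = (\<lambda>(z, i). (real z, i)) ` ends"
    by (force simp: end_points_def ends_def)
  thus ?thesis
    by (simp add: vertices_def end_vertex_def image_image split_beta)
qed

text \<open>
  Unlike paths, walks carry their two extreme vertices and may be empty. So they can be
  concatenated and reversed freely, and cut into singular segments between regular edges.
\<close>

fun walk :: "(real \<times> nat) set \<Rightarrow> (nat \<times> nat) list \<Rightarrow> (real \<times> nat) set \<Rightarrow> bool" where
  "walk p [] q \<longleftrightarrow> p = q"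
| "walk p (e # P) q \<longleftrightarrow> e \<in> ends \<and> end_vertex e = p \<and> walk (end_vertex (opposite e)) P q"

lemma walk_append:
  "walk p (P @ P') q \<longleftrightarrow> (\<exists>s. walk p P s \<and> walk s P' q)"
  by (induction P arbitrary: p) auto

lemma walk_rev: "walk p P q \<Longrightarrow> walk q (rev (map opposite P)) p"
  by (induction P arbitrary: p) (auto simp: walk_append)

lemma walk_in_ends: "walk p P q \<Longrightarrow> set P \<subseteq> ends"
  by (induction P arbitrary: p) auto

lemma is_path_Cons_Cons:
  "is_path (e # f # P) \<longleftrightarrow>
     e \<in> ends \<and> end_vertex (opposite e) = end_vertex f \<and> is_path (f # P)"
  unfolding is_path_def by (auto simp: nth_Cons split: nat.splits)

lemma is_path_iff_walk:
  "is_path P \<longleftrightarrow> P \<noteq> [] \<and> walk (end_vertex (hd P)) P (end_vertex (opposite (last P)))"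
proof (cases P)
  case (Cons e P')
  have "is_path (e # P') \<longleftrightarrow> walk (end_vertex e) (e # P') (end_vertex (opposite (last (e # P'))))"
  proof (induction P' arbitrary: e)
    case Nil
    show ?case by (simp add: is_path_def)
  next
    case (Cons f P')
    show ?case
      unfolding is_path_Cons_Cons Cons.IH by auto
  qed
  with Cons show ?thesis by simp
qed (simp add: is_path_def)

lemma is_cycle_iff_walk:
  "is_cycle P \<longleftrightarrow> P \<noteq> [] \<and> walk (end_vertex (hd P)) P (end_vertex (hd P))"
proof (cases "P = []")
  case False
  have final: "q = end_vertex (opposite (last P))" if "walk p P q" for p q
    using that False by (induction P arbitrary: p) (auto split: if_splits)
  show ?thesis
  proof
    assume "is_cycle P"
    thus "P \<noteq> [] \<and> walk (end_vertex (hd P)) P (end_vertex (hd P))"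
      unfolding is_cycle_def is_path_iff_walk by metis
  next
    assume *: "P \<noteq> [] \<and> walk (end_vertex (hd P)) P (end_vertex (hd P))"
    hence "end_vertex (opposite (last P)) = end_vertex (hd P)"
      by (metis final)
    with * show "is_cycle P"
      unfolding is_cycle_def is_path_iff_walk by metis
  qed
qed (simp add: is_cycle_def is_path_def)

end


section \<open>Path angles as products of transport factors\<close>

context angle_graph
begin

definition cdir :: "nat \<times> nat \<Rightarrow> complex" where
  "cdir e = cplx (dir e)"

text \<open>
  If rotations \<open>r\<close> and \<open>r'\<close> at the two ends of an edge carry the assigned directions to opposite
  vectors, then \<open>r'\<close> is \<open>r\<close> times this factor.
\<close>

definition transport :: "nat \<times> nat \<Rightarrow> complex" where
  "transport e = - cdir e / cdir (opposite e)"

definition path_transport :: "(nat \<times> nat) list \<Rightarrow> complex" where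
  "path_transport P = prod_list (map transport P)"

lemma path_transport_simps [simp]:
  "path_transport [] = 1"
  "path_transport (e # P) = transport e * path_transport P"
  "path_transport (P @ P') = path_transport P * path_transport P'"
  by (simp_all add: path_transport_def)

lemma norm_dir [simp]: "e \<in> ends \<Longrightarrow> norm (dir e) = 1"
  using norm_d by (cases e) (simp add: dir_def)

lemma norm_cdir [simp]: "e \<in> ends \<Longrightarrow> norm (cdir e) = 1"
  by (simp add: cdir_def)

lemma cdir_nonzero [simp]: "e \<in> ends \<Longrightarrow> cdir e \<noteq> 0"
  using norm_cdir by (metis norm_zero zero_neq_one)

lemma norm_path_transport: "set P \<subseteq> ends \<Longrightarrow> norm (path_transport P) = 1"
  by (induction P) (auto simp: norm_mult norm_divide transport_def)

lemma path_transport_rev: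
  "set P \<subseteq> ends \<Longrightarrow> path_transport (rev (map opposite P)) = inverse (path_transport P)"
  by (induction P) (auto simp: transport_def field_simps)

lemma open_path_angle_Cons_Cons:
  "open_path_angle (e # f # P) = ccw_angle (- dir (opposite e)) (dir f) + open_path_angle (f # P)"
  by (simp add: open_path_angle_def sum.lessThan_Suc_shift del: sum.lessThan_Suc)

text \<open>
  Each edge in the interior of the path contributes to two consecutive turning angles: in the first
  through the direction in which it is entered, in the second through the direction in which it is
  left. The product of the two contributions is its transport factor.
\<close>

lemma cis_open_path_angle:
  assumes "e \<in> ends" "f \<in> ends" "set P \<subseteq> ends"
  shows "cis (open_path_angle (e # P @ [f])) = - (cdir f / cdir (opposite e)) * path_transport P"
  using assms
proof (induction P arbitrary: e)
  case Nil
  thus ?case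
    by (simp add: open_path_angle_def cis_ccw_angle cdir_def)
next
  case (Cons g P)
  have "cis (open_path_angle (e # g # P @ [f])) =
      - (cdir g / cdir (opposite e)) * cis (open_path_angle (g # P @ [f]))"
    using Cons.prems
    by (simp add: open_path_angle_Cons_Cons cis_ccw_angle cdir_def flip: cis_mult)
  also have "\<dots> = - (cdir f / cdir (opposite e)) * path_transport (g # P)"
    using Cons by (simp add: transport_def)
  finally show ?case by simp
qed

lemma cycle_angle_eq_open_path_angle:
  assumes "P \<noteq> []"
  shows "cycle_angle P = open_path_angle (P @ [hd P])"
  unfolding cycle_angle_def open_path_angle_def
proof (rule sum.cong)
  fix j assume "j \<in> {..<length (P @ [hd P]) - 1}"
  hence "j < length P" by simp
  moreover have "P ! (Suc j mod length P) = (P @ [hd P]) ! Suc j"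
    using \<open>j < length P\<close> assms
    by (cases "Suc j = length P") (simp_all add: nth_append hd_conv_nth)
  ultimately show "ccw_angle (- dir (opposite (P ! j))) (dir (P ! (Suc j mod length P))) =
      ccw_angle (- dir (opposite ((P @ [hd P]) ! j))) (dir ((P @ [hd P]) ! Suc j))"
    by (simp add: nth_append)
qed simp

lemma cis_cycle_angle:
  assumes "P \<noteq> []" "set P \<subseteq> ends"
  shows "cis (cycle_angle P) = path_transport P"
proof -
  obtain e P' where P: "P = e # P'"
    using assms(1) by (cases P) auto
  show ?thesis
    unfolding cycle_angle_eq_open_path_angle[OF assms(1)]
    using assms(2) by (simp add: P cis_open_path_angle transport_def)
qed

end


section \<open>Framings\<close>

context network
begin

lemma Reg_Int_Sing: "Reg \<inter> Sing = {}"
proof -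
  have "curve_deriv u 0 = 0" if const: "u constant_on {0..1}" for u
  proof -
    obtain c where c: "\<And>t. t \<in> {0..1} \<Longrightarrow> u t = c"
      using const unfolding constant_on_def by blast
    have "((\<lambda>_. c) has_vector_derivative 0) (at 0 within {0..1})"
      by simp
    hence "(u has_vector_derivative 0) (at 0 within {0..1})"
      by (rule has_vector_derivative_transform[rotated 2]) (use c in auto)
    hence "vector_derivative u (at 0 within {0..1}) = 0"
      by (intro vector_derivative_within_closed_interval) auto
    thus ?thesis
      by (simp add: curve_deriv_def)
  qed
  thus ?thesis
    unfolding Reg_def Sing_def immersion_def by fastforce
qed

lemma norm_outer_tangent:
  assumes "e \<in> ends" "snd e \<in> Reg"
  shows "norm (outer_tangent e) = 1"
  using assms by (auto simp: outer_tangent_def Reg_def immersion_def ends_def)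

text \<open>\<open>r p\<close> stands for the rotation at the vertex \<open>p\<close>.\<close>

definition framing :: "((real \<times> nat) set \<Rightarrow> complex) \<Rightarrow> bool" where
  "framing r \<longleftrightarrow>
     (\<forall>p\<in>vertices. norm (r p) = 1) \<and>
     (\<forall>e\<in>ends. snd e \<in> Reg \<longrightarrow> cplx (outer_tangent e) = r (end_vertex e) * cdir e) \<and>
     (\<forall>e\<in>ends. snd e \<in> Sing \<longrightarrow>
        r (end_vertex (opposite e)) = transport e * r (end_vertex e))"

text \<open>
  The rotations that belong to a choice of virtual tangents form a framing: the two tangents of a
  singular edge are opposite, and this is the transport equation. Conversely, rotating the assigned
  directions at the ends of singular edges by a framing yields virtual tangents.
\<close>

lemma virtual_angle_condition_iff_framing: "virtual_angle_condition \<longleftrightarrow> (\<exists>r. framing r)"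
proof
  assume virtual_angle_condition
  then obtain \<sigma> where
    \<sigma>: "\<And>i. i \<in> Sing \<Longrightarrow> \<sigma> (0, i) = - \<sigma> (1, i)" and
    rot: "\<And>p. p \<in> vertices \<Longrightarrow> \<exists>Q :: real ^ 2 ^ 2. rotation_matrix Q \<and>
      (\<forall>e\<in>ends_at p. True \<longrightarrow> (if snd e \<in> Reg then outer_tangent e else \<sigma> e) = Q *v dir e)"
    unfolding virtual_angle_condition_def by auto
  from rot obtain r where r: "\<And>p. p \<in> vertices \<Longrightarrow> norm (r p) = 1 \<and>
      (\<forall>e\<in>ends_at p. cplx (if snd e \<in> Reg then outer_tangent e else \<sigma> e) = r p * cdir e)"
    unfolding ex_rotation_matrix_iff_ex_unit cdir_def by metis
  have at: "end_vertex e \<in> vertices" "e \<in> ends_at (end_vertex e)" if "e \<in> ends" for e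
    using that by (auto simp: vertices_eq ends_at_def)
  have sing: "cplx (\<sigma> e) = r (end_vertex e) * cdir e" if "e \<in> ends" "snd e \<in> Sing" for e
  proof -
    have "snd e \<notin> Reg"
      using that(2) Reg_Int_Sing by blast
    moreover have "cplx (if snd e \<in> Reg then outer_tangent e else \<sigma> e) = r (end_vertex e) * cdir e"
      using r[OF at(1)] at(2) that(1) by blast
    ultimately show ?thesis by simp
  qed
  have "framing r"
    unfolding framing_def
  proof (intro conjI ballI impI)
    fix e assume e: "e \<in> ends" "snd e \<in> Sing"
    have "\<sigma> (opposite e) = - \<sigma> e"
      using e \<sigma> by (auto simp: ends_def opposite_def)
    hence "r (end_vertex (opposite e)) * cdir (opposite e) = - (r (end_vertex e) * cdir e)"
      using sing[OF e] sing[of "opposite e"] e by simp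
    thus "r (end_vertex (opposite e)) = transport e * r (end_vertex e)"
      using e by (simp add: transport_def field_simps)
  next
    fix e assume e: "e \<in> ends" "snd e \<in> Reg"
    have "cplx (if snd e \<in> Reg then outer_tangent e else \<sigma> e) = r (end_vertex e) * cdir e"
      using r[OF at(1)] at(2) e(1) by blast
    thus "cplx (outer_tangent e) = r (end_vertex e) * cdir e"
      using e(2) by simp
  qed (use r in blast)
  thus "\<exists>r. framing r" by blast
next
  assume "\<exists>r. framing r"
  then obtain r where
    unit: "\<And>p. p \<in> vertices \<Longrightarrow> norm (r p) = 1" and
    reg: "\<And>e. e \<in> ends \<Longrightarrow> snd e \<in> Reg \<Longrightarrow>
      cplx (outer_tangent e) = r (end_vertex e) * cdir e" and
    sing: "\<And>e. e \<in> ends \<Longrightarrow> snd e \<in> Sing \<Longrightarrow>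
      r (end_vertex (opposite e)) = transport e * r (end_vertex e)"
    unfolding framing_def by blast
  have "\<forall>e. \<exists>v. cplx v = r (end_vertex e) * cdir e"
    using cplx_surj by blast
  then obtain \<sigma> where \<sigma>: "\<And>e. cplx (\<sigma> e) = r (end_vertex e) * cdir e"
    by metis
  have norm_\<sigma>: "norm (\<sigma> e) = 1" if "e \<in> ends" for e
  proof -
    have "norm (cplx (\<sigma> e)) = 1"
      using that unit by (simp add: \<sigma> norm_mult vertices_eq)
    thus ?thesis by simp
  qed
  have opp: "\<sigma> e = - \<sigma> (opposite e)" if "e \<in> ends" "snd e \<in> Sing" for e
  proof -
    have "cplx (\<sigma> e) = cplx (- \<sigma> (opposite e))"
      using that by (simp add: \<sigma> sing transport_def)
    thus ?thesis unfolding cplx_eq_iff .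
  qed
  show virtual_angle_condition
    unfolding virtual_angle_condition_def
  proof (intro exI[of _ \<sigma>] conjI ballI)
    fix i assume i: "i \<in> Sing"
    hence "(0, i) \<in> ends" "(1, i) \<in> ends"
      by (auto simp: ends_def Sing_def)
    thus "norm (\<sigma> (0, i)) = 1" "norm (\<sigma> (1, i)) = 1" "\<sigma> (0, i) = - \<sigma> (1, i)"
      using norm_\<sigma> opp[of "(0, i)"] i by (auto simp: opposite_def)
  next
    fix p assume p: "p \<in> vertices"
    have "\<exists>c. norm c = 1 \<and> (\<forall>e\<in>ends_at p. True \<longrightarrow>
        cplx (if snd e \<in> Reg then outer_tangent e else \<sigma> e) = c * cplx (dir e))"
      using unit[OF p] reg \<sigma> by (intro exI[of _ "r p"]) (auto simp: ends_at_def cdir_def)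
    thus "\<exists>Q :: real ^ 2 ^ 2. rotation_matrix Q \<and>
        (\<forall>e\<in>ends_at p. (if snd e \<in> Reg then outer_tangent e else \<sigma> e) = Q *v dir e)"
      unfolding ex_rotation_matrix_iff_ex_unit[symmetric] by simp
  qed
qed

lemma framing_walk:
  assumes "framing r" "walk p P q" "\<forall>e\<in>set P. snd e \<in> Sing"
  shows "r q = path_transport P * r p"
  using assms(2,3)
proof (induction P arbitrary: p)
  case (Cons e P)
  have "r (end_vertex (opposite e)) = transport e * r p"
    using assms(1) Cons.prems by (auto simp: framing_def)
  moreover have "r q = path_transport P * r (end_vertex (opposite e))"
    using Cons by simp
  ultimately show ?case by simp
qed simp

text \<open>
  Here \<open>a\<close> and \<open>b\<close> are the rotations at the vertices where a path leaves its first edge and enters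
  its last one. By comparison with \<open>cis_open_path_angle\<close>, the two angles agree modulo \<open>2\<pi>\<close> if and only
  if the transport factors in between multiply to \<open>b / a\<close>.
\<close>

lemma cis_tangent_angle:
  assumes "e \<in> ends" "f \<in> ends" "snd e \<in> Reg" "snd f \<in> Reg"
    and "cplx (outer_tangent (opposite e)) = a * cdir (opposite e)"
    and "cplx (outer_tangent f) = b * cdir f"
  shows "cis (ccw_angle (- outer_tangent (opposite e)) (outer_tangent f)) =
    - (cdir f / cdir (opposite e)) * (b / a)"
proof -
  have "cis (ccw_angle (- outer_tangent (opposite e)) (outer_tangent f)) =
      (b * cdir f) / - (a * cdir (opposite e))"
    using assms by (simp add: cis_ccw_angle norm_outer_tangent)
  thus ?thesis
    by (simp add: mult.commute)
qed

text \<open>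
  Splitting off the two regular edges leaves a singular walk in between, possibly empty, to which
  transport applies.
\<close>

lemma regular_path_condition_iff_walk:
  "regular_path_condition \<longleftrightarrow>
    (\<forall>e f P. e \<in> ends \<and> f \<in> ends \<and> snd e \<in> Reg \<and> snd f \<in> Reg \<and>
       walk (end_vertex (opposite e)) P (end_vertex f) \<and> (\<forall>g\<in>set P. snd g \<in> Sing) \<longrightarrow>
       cis (open_path_angle (e # P @ [f])) =
         cis (ccw_angle (- outer_tangent (opposite e)) (outer_tangent f)))" (is "_ \<longleftrightarrow> ?R")
proof -
  have path: "is_path (e # P @ [f]) \<longleftrightarrow>
      e \<in> ends \<and> f \<in> ends \<and> walk (end_vertex (opposite e)) P (end_vertex f)" for e f P
    by (auto simp: is_path_iff_walk walk_append)
  have interior: "(\<forall>j. 0 < j \<and> j < length (e # P @ [f]) - 1 \<longrightarrow> snd ((e # P @ [f]) ! j) \<in> Sing)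
      \<longleftrightarrow> (\<forall>g\<in>set P. snd g \<in> Sing)" for e f :: "nat \<times> nat" and P
  proof -
    have shift: "(e # P @ [f]) ! Suc k = P ! k" if "k < length P" for k
      using that by (simp add: nth_append)
    have "(\<forall>j. 0 < j \<and> j < length (e # P @ [f]) - 1 \<longrightarrow> snd ((e # P @ [f]) ! j) \<in> Sing)
        \<longleftrightarrow> (\<forall>k. k < length P \<longrightarrow> snd ((e # P @ [f]) ! Suc k) \<in> Sing)"
    proof (intro iffI allI impI)
      fix j assume shifted: "\<forall>k. k < length P \<longrightarrow> snd ((e # P @ [f]) ! Suc k) \<in> Sing"
        and j: "0 < j \<and> j < length (e # P @ [f]) - 1"
      then obtain k where "j = Suc k" "k < length P"
        by (cases j) auto
      with shifted show "snd ((e # P @ [f]) ! j) \<in> Sing" by blast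
    next
      fix k assume "\<forall>j. 0 < j \<and> j < length (e # P @ [f]) - 1 \<longrightarrow> snd ((e # P @ [f]) ! j) \<in> Sing"
        and "k < length P"
      thus "snd ((e # P @ [f]) ! Suc k) \<in> Sing"
        by (elim allE[of _ "Suc k"]) simp
    qed
    also have "\<dots> \<longleftrightarrow> (\<forall>k<length P. snd (P ! k) \<in> Sing)"
      by (simp only: shift cong: imp_cong)
    also have "\<dots> \<longleftrightarrow> (\<forall>g\<in>set P. snd g \<in> Sing)"
      by (simp only: all_set_conv_all_nth)
    finally show ?thesis .
  qed
  have long: "2 \<le> length Q \<longleftrightarrow> (\<exists>e P f. Q = e # P @ [f])" for Q :: "(nat \<times> nat) list"
  proof
    assume "2 \<le> length Q"
    then obtain e Q' where "Q = e # Q'" "Q' \<noteq> []"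
      by (cases Q) (auto simp: Suc_le_length_iff)
    moreover from this obtain P f where "Q' = P @ [f]"
      using rev_exhaust by blast
    ultimately show "\<exists>e P f. Q = e # P @ [f]" by blast
  qed auto
  have "regular_path_condition \<longleftrightarrow>
      (\<forall>e f P. is_path (e # P @ [f]) \<and>
        (\<forall>j. 0 < j \<and> j < length (e # P @ [f]) - 1 \<longrightarrow> snd ((e # P @ [f]) ! j) \<in> Sing) \<and>
        snd e \<in> Reg \<and> snd f \<in> Reg \<longrightarrow>
        cis (open_path_angle (e # P @ [f])) =
          cis (ccw_angle (- outer_tangent (opposite e)) (outer_tangent f)))"
    unfolding regular_path_condition_def long cis_eq_iff[symmetric] by fastforce
  also have "\<dots> \<longleftrightarrow> ?R"
    unfolding path interior by blast
  finally show ?thesis .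
qed

text \<open>
  Along a singular walk a framing gets multiplied by the product of the transport factors. Around a
  cycle this product is therefore \<open>1\<close>, and between two regular edges it is the quotient of the
  rotations of their tangents.
\<close>

lemma framing_imp_path_angle_condition:
  assumes fr: "framing r"
  shows path_angle_condition
proof -
  have unit: "norm (r (end_vertex e)) = 1" if "e \<in> ends" for e
    using fr that by (auto simp: framing_def vertices_eq)
  hence nz: "r (end_vertex e) \<noteq> 0" if "e \<in> ends" for e
    using that by (metis norm_zero zero_neq_one)
  have reg: "cplx (outer_tangent e) = r (end_vertex e) * cdir e"
    if "e \<in> ends" "snd e \<in> Reg" for e
    using fr that by (auto simp: framing_def)
  have regular_angle_condition
    unfolding regular_angle_condition_def ex_rotation_matrix_iff_ex_unit
  proof
    fix p assume "p \<in> vertices"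
    thus "\<exists>c. norm c = 1 \<and>
        (\<forall>e\<in>ends_at p. snd e \<in> Reg \<longrightarrow> cplx (outer_tangent e) = c * cplx (dir e))"
      using fr reg by (intro exI[of _ "r p"]) (auto simp: framing_def ends_at_def cdir_def)
  qed
  moreover have singular_cycle_condition
    unfolding singular_cycle_condition_def
  proof (intro allI impI, elim conjE)
    fix P assume P: "is_cycle P" "\<forall>e\<in>set P. snd e \<in> Sing"
    hence w: "P \<noteq> []" "walk (end_vertex (hd P)) P (end_vertex (hd P))"
      by (auto simp: is_cycle_iff_walk)
    have ends: "set P \<subseteq> ends"
      using walk_in_ends[OF w(2)] .
    hence "r (end_vertex (hd P)) \<noteq> 0"
      using w(1) nz hd_in_set by blast
    hence "path_transport P = 1"
      using framing_walk[OF fr w(2) P(2)] by simp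
    hence "cis (cycle_angle P) = cis 0"
      using cis_cycle_angle[OF w(1) ends] by simp
    thus "[cycle_angle P = 0] (rmod 2 * pi)"
      unfolding cis_eq_iff .
  qed
  moreover have regular_path_condition
    unfolding regular_path_condition_iff_walk
  proof (intro allI impI, elim conjE)
    fix e f P
    assume e: "e \<in> ends" "snd e \<in> Reg" and f: "f \<in> ends" "snd f \<in> Reg"
      and w: "walk (end_vertex (opposite e)) P (end_vertex f)" and P: "\<forall>g\<in>set P. snd g \<in> Sing"
    have "path_transport P = r (end_vertex f) / r (end_vertex (opposite e))"
      using framing_walk[OF fr w P] nz[of "opposite e"] e by simp
    thus "cis (open_path_angle (e # P @ [f])) =
        cis (ccw_angle (- outer_tangent (opposite e)) (outer_tangent f))"
      using e f walk_in_ends[OF w] reg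
      by (subst cis_tangent_angle[where a = "r (end_vertex (opposite e))"
            and b = "r (end_vertex f)"]) (auto simp: cis_open_path_angle)
  qed
  ultimately show ?thesis
    by (simp add: path_angle_condition_def)
qed

text \<open>
  The potential lemma applies to transport along singular walks, with the values prescribed at the
  vertices of regular edges by the angle condition for regular curves.
\<close>

lemma path_angle_condition_imp_framing:
  assumes path_angle_condition
  shows "\<exists>r. framing r"
proof -
  from assms have "regular_angle_condition"
    and cyc: singular_cycle_condition and regp: regular_path_condition
    by (auto simp: path_angle_condition_def)
  then obtain b where b: "\<And>p. p \<in> vertices \<Longrightarrow> norm (b p) = 1 \<and>
      (\<forall>e\<in>ends_at p. snd e \<in> Reg \<longrightarrow> cplx (outer_tangent e) = b p * cdir e)"
    unfolding regular_angle_condition_def ex_rotation_matrix_iff_ex_unit cdir_def by metis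
  have reg: "cplx (outer_tangent e) = b (end_vertex e) * cdir e"
    if "e \<in> ends" "snd e \<in> Reg" for e
  proof -
    have "end_vertex e \<in> vertices" "e \<in> ends_at (end_vertex e)"
      using that by (auto simp: vertices_eq ends_at_def)
    thus ?thesis
      using b that(2) by blast
  qed
  have unit_b: "norm (b (end_vertex e)) = 1" if "e \<in> ends" for e
    using b that by (auto simp: vertices_eq)
  define B where "B = end_vertex ` {e \<in> ends. snd e \<in> Reg}"
  define T where "T p q a \<longleftrightarrow>
    (\<exists>P. walk p P q \<and> (\<forall>e\<in>set P. snd e \<in> Sing) \<and> a = path_transport P)" for p q a
  obtain r where r: "\<And>p. norm (r p) = 1" "\<And>p. p \<in> B \<Longrightarrow> r p = b p"
    "\<And>p q a. T p q a \<Longrightarrow> r q = a * r p"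
  proof (rule multiplicative_potential_exists[of T B b])
    show "T p p 1" for p
      unfolding T_def by (rule exI[of _ "[]"]) simp
    show "T p s (a * c)" if pq: "T p q a" and qs: "T q s c" for p q s a c
    proof -
      obtain P where P: "walk p P q" "\<forall>e\<in>set P. snd e \<in> Sing" "a = path_transport P"
        using pq by (auto simp: T_def)
      obtain S where S: "walk q S s" "\<forall>e\<in>set S. snd e \<in> Sing" "c = path_transport S"
        using qs by (auto simp: T_def)
      from P S show ?thesis
        unfolding T_def by (intro exI[of _ "P @ S"]) (auto simp: walk_append)
    qed
    show "T q p (inverse a)" if pq: "T p q a" for p q a
    proof -
      obtain P where P: "walk p P q" "\<forall>e\<in>set P. snd e \<in> Sing" "a = path_transport P"
        using pq by (auto simp: T_def)
      thus ?thesis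
        unfolding T_def
        by (intro exI[of _ "rev (map opposite P)"])
          (auto simp: walk_rev path_transport_rev walk_in_ends)
    qed
    show "norm a = 1" if "T p q a" for p q a
      using that by (auto simp: T_def intro!: norm_path_transport dest: walk_in_ends)
    show "a = 1" if pp: "T p p a" for p a
    proof -
      obtain P where P: "walk p P p" "\<forall>e\<in>set P. snd e \<in> Sing" "a = path_transport P"
        using pp by (auto simp: T_def)
      show ?thesis
      proof (cases "P = []")
        case False
        hence "end_vertex (hd P) = p"
          using P(1) by (cases P) auto
        hence "is_cycle P"
          using P(1) False by (simp add: is_cycle_iff_walk)
        hence "cis (cycle_angle P) = cis 0"
          using cyc P(2) unfolding singular_cycle_condition_def cis_eq_iff by blast
        thus ?thesis
          using cis_cycle_angle[OF False walk_in_ends[OF P(1)]] P(3) by simp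
      qed (simp add: P(3))
    qed
    show "norm (b p) = 1" if "p \<in> B" for p
      using that unit_b by (auto simp: B_def)
    show "b q = a * b p" if pq: "T p q a" and "p \<in> B" "q \<in> B" for p q a
    proof -
      obtain P where P: "walk p P q" "\<forall>e\<in>set P. snd e \<in> Sing" "a = path_transport P"
        using pq by (auto simp: T_def)
      obtain e f where e: "e \<in> ends" "snd e \<in> Reg" "end_vertex e = p"
        and f: "f \<in> ends" "snd f \<in> Reg" "end_vertex f = q"
        using \<open>p \<in> B\<close> \<open>q \<in> B\<close> by (auto simp: B_def)
      \<comment> \<open>The path runs along the regular edge of \<open>e\<close> towards \<open>p\<close>, hence starts at the other end.\<close>
      have "cis (open_path_angle (opposite e # P @ [f])) =
          cis (ccw_angle (- outer_tangent (opposite (opposite e))) (outer_tangent f))"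
        using regp[unfolded regular_path_condition_iff_walk, rule_format, of "opposite e" f P] e f P
        by simp
      also have "\<dots> = - (cdir f / cdir e) * (b q / b p)"
        using e f reg by (subst cis_tangent_angle[where a = "b p" and b = "b q"]) auto
      finally have "- (cdir f / cdir e) * a = - (cdir f / cdir e) * (b q / b p)"
        using e f walk_in_ends[OF P(1)] by (simp add: cis_open_path_angle P(3))
      moreover have "- (cdir f / cdir e) \<noteq> 0"
        using e f by simp
      ultimately have "a = b q / b p"
        by (metis mult_left_cancel)
      moreover have "b p \<noteq> 0"
        using unit_b[OF e(1)] e(3) by auto
      ultimately show ?thesis by simp
    qed
  qed blast
  have "framing r"
    unfolding framing_def
  proof (intro conjI ballI impI)
    fix e assume e: "e \<in> ends" "snd e \<in> Reg"
    thus "cplx (outer_tangent e) = r (end_vertex e) * cdir e"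
      using r(2)[of "end_vertex e"] reg by (auto simp: B_def)
  next
    fix e assume "e \<in> ends" "snd e \<in> Sing"
    hence "T (end_vertex e) (end_vertex (opposite e)) (transport e)"
      unfolding T_def by (intro exI[of _ "[e]"]) simp
    thus "r (end_vertex (opposite e)) = transport e * r (end_vertex e)"
      by (rule r(3))
  qed (rule r(1))
  thus ?thesis by blast
qed

end

theorem proposition6p8:
  fixes N :: nat
    and R :: "((real \<times> nat) \<times> (real \<times> nat)) set"
    and d :: "nat \<Rightarrow> nat \<Rightarrow> real ^ 2"
    and \<Gamma> :: "(real \<times> nat) set \<Rightarrow> real ^ 2"
  assumes "network N R d \<Gamma>"
  shows "network.path_angle_condition N R d \<Gamma> \<longleftrightarrow> network.virtual_angle_condition N R d \<Gamma>"
proof -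
  interpret network N R d \<Gamma> by fact
  show ?thesis
    unfolding virtual_angle_condition_iff_framing
    using framing_imp_path_angle_condition path_angle_condition_imp_framing by blast
qed

end
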